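(* Let $\mathcal I$ and $\mathcal J$ be ideals on $\mathbb N$. Then the Banach spaces $c_{0,\mathcal I}$ and $c_{0,\mathcal J}$ are isometric (that is, there is a linear isometry from $c_{0,\mathcal I}$ onto $c_{0,\mathcal J}$) if, and only if, $\mathcal I$ and $\mathcal J$ are isomorphic.
   Context: An ideal on a set $S$ is a collection of subsets of $S$ containing $\emptyset$, closed under taking subsets and under finite unions; it is always assumed to contain every finite subset of $S$ (it need not be proper). Two ideals $\mathcal I,\mathcal J$ on $\mathbb N$ are isomorphic if there is a bijection $f\colon\mathbb N\to\mathbb N$ such that for all $A\subseteq\mathbb N$: $A\in\mathcal J$ iff $f^{-1}(A)\in\mathcal I$. For an ideal $\mathcal I$ on $\mathbb N$, $c_{0,\mathcal I}$ is the space of all bounded real sequences $(x_n)\in\ell_\infty$ such that $\{n\in\mathbb N: |x_n|\ge\varepsilon\}\in\mathcal I$ for every $\varepsilon>0$, endowed with the sup norm. *)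

theory Defs
  imports "HOL-Analysis.Analysis"
begin

definition set_ideal_on :: "'a set \<Rightarrow> 'a set set \<Rightarrow> bool" where
  "set_ideal_on S \<I> \<longleftrightarrow>
     \<I> \<subseteq> Pow S \<and>
     {} \<in> \<I> \<and>
     (\<forall>A B. A \<in> \<I> \<longrightarrow> B \<subseteq> A \<longrightarrow> B \<in> \<I>) \<and>
     (\<forall>A B. A \<in> \<I> \<longrightarrow> B \<in> \<I> \<longrightarrow> A \<union> B \<in> \<I>) \<and>
     (\<forall>A. A \<subseteq> S \<longrightarrow> finite A \<longrightarrow> A \<in> \<I>)"

definition isomorphic_ideals :: "nat set set \<Rightarrow> nat set set \<Rightarrow> bool" where
  "isomorphic_ideals \<I> \<J> \<longleftrightarrow>
     (\<exists>f :: nat \<Rightarrow> nat. bij f \<and> (\<forall>A. A \<in> \<J> \<longleftrightarrow> f -` A \<in> \<I>))"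

text \<open>Since \<open>nat\<close> carries the discrete topology, every sequence is continuous, and
  \<open>nat \<Rightarrow>\<^sub>C real\<close> is the space of all bounded real sequences with the sup norm.\<close>

type_synonym ell_infty = "nat \<Rightarrow>\<^sub>C real"

definition c0_ideal :: "nat set set \<Rightarrow> ell_infty set" where
  "c0_ideal \<I> = {x. \<forall>\<epsilon>>0. {n. \<bar>apply_bcontfun x n\<bar> \<ge> \<epsilon>} \<in> \<I>}"

text \<open>Intended for linear subspaces \<open>V\<close> and \<open>W\<close>, with the norms of the ambient types.
  Only the values of \<open>T\<close> on \<open>V\<close> matter; injectivity follows from norm preservation.\<close>

definition linearly_isometric ::
    "'a::real_normed_vector set \<Rightarrow> 'b::real_normed_vector set \<Rightarrow> bool" where
  "linearly_isometric V W \<longleftrightarrow>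
     (\<exists>T :: 'a \<Rightarrow> 'b.
        (\<forall>x\<in>V. \<forall>y\<in>V. T (x + y) = T x + T y) \<and>
        (\<forall>c. \<forall>x\<in>V. T (c *\<^sub>R x) = c *\<^sub>R T x) \<and>
        (\<forall>x\<in>V. norm (T x) = norm x) \<and>
        T ` V = W)"

text \<open>The library only defines the norm of a bounded continuous function through its metric.\<close>

lemma norm_ell_infty: "norm (x :: ell_infty) = (SUP n. \<bar>apply_bcontfun x n\<bar>)"
  unfolding norm_bcontfun_def dist_bcontfun.rep_eq
  by simp

lemma bounded_seq_in_ell_infty:
  fixes x :: "nat \<Rightarrow> real"
  assumes "bounded (range x)"
  shows "apply_bcontfun (Bcontfun x :: ell_infty) = x"
  using assms by (intro Bcontfun_inverse) (simp add: bcontfun_def)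

lemma subspace_c0_ideal:
  assumes "set_ideal_on UNIV \<I>"
  shows "subspace (c0_ideal \<I>)"
proof (rule subspaceI)
  have empty: "{} \<in> \<I>"
    using assms by (simp add: set_ideal_on_def)
  have sub: "B \<in> \<I>" if "A \<in> \<I>" "B \<subseteq> A" for A B
    using assms that unfolding set_ideal_on_def by blast
  have un: "A \<union> B \<in> \<I>" if "A \<in> \<I>" "B \<in> \<I>" for A B
    using assms that unfolding set_ideal_on_def by blast
  show zero: "0 \<in> c0_ideal \<I>"
    using empty by (simp add: c0_ideal_def not_le)
  show "x + y \<in> c0_ideal \<I>" if x: "x \<in> c0_ideal \<I>" and y: "y \<in> c0_ideal \<I>" for x y
    unfolding c0_ideal_def mem_Collect_eq
  proof (intro allI impI)
    fix \<epsilon> :: real assume "\<epsilon> > 0"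
    then have "\<epsilon>/2 > 0" by simp
    then have "{n. \<bar>apply_bcontfun x n\<bar> \<ge> \<epsilon>/2} \<union> {n. \<bar>apply_bcontfun y n\<bar> \<ge> \<epsilon>/2} \<in> \<I>"
      using x y un unfolding c0_ideal_def mem_Collect_eq by blast
    moreover have "{n. \<bar>apply_bcontfun (x + y) n\<bar> \<ge> \<epsilon>} \<subseteq>
        {n. \<bar>apply_bcontfun x n\<bar> \<ge> \<epsilon>/2} \<union> {n. \<bar>apply_bcontfun y n\<bar> \<ge> \<epsilon>/2}"
    proof
      fix n assume "n \<in> {n. \<bar>apply_bcontfun (x + y) n\<bar> \<ge> \<epsilon>}"
      then have "\<epsilon> \<le> \<bar>apply_bcontfun x n + apply_bcontfun y n\<bar>"
        by (simp add: plus_bcontfun.rep_eq)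
      then have "\<epsilon>/2 \<le> \<bar>apply_bcontfun x n\<bar> \<or> \<epsilon>/2 \<le> \<bar>apply_bcontfun y n\<bar>"
        by linarith
      then show "n \<in> {n. \<bar>apply_bcontfun x n\<bar> \<ge> \<epsilon>/2} \<union> {n. \<bar>apply_bcontfun y n\<bar> \<ge> \<epsilon>/2}"
        by simp
    qed
    ultimately show "{n. \<bar>apply_bcontfun (x + y) n\<bar> \<ge> \<epsilon>} \<in> \<I>"
      by (rule sub)
  qed
  show "c *\<^sub>R x \<in> c0_ideal \<I>" if x: "x \<in> c0_ideal \<I>" for c x
  proof (cases "c = 0")
    case True
    then show ?thesis using zero by simp
  next
    case False
    show ?thesis
      unfolding c0_ideal_def mem_Collect_eq
    proof (intro allI impI)
      fix \<epsilon> :: real assume "\<epsilon> > 0"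
      have "{n. \<bar>apply_bcontfun (c *\<^sub>R x) n\<bar> \<ge> \<epsilon>} = {n. \<bar>apply_bcontfun x n\<bar> \<ge> \<epsilon>/\<bar>c\<bar>}"
        using False by (simp add: scaleR_bcontfun.rep_eq abs_mult pos_divide_le_eq mult.commute)
      moreover have "\<epsilon>/\<bar>c\<bar> > 0"
        using False \<open>\<epsilon> > 0\<close> by simp
      ultimately show "{n. \<bar>apply_bcontfun (c *\<^sub>R x) n\<bar> \<ge> \<epsilon>} \<in> \<I>"
        using x unfolding c0_ideal_def by simp
    qed
  qed
qed

end

theory Submission
  imports Defs
begin

text \<open>The unit vectors \<open>e\<^sub>n\<close> are, up to sign, exactly the norm one elements \<open>x\<close> whose line is a
  summand in the sense of the maximum norm; the condition \<open>peak\<close> below captures this in terms of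
  the norm and the linear structure only. Hence a linear isometry \<open>T\<close> of \<open>c\<^sub>0\<^sub>,\<^sub>\<I>\<close> onto \<open>c\<^sub>0\<^sub>,\<^sub>\<J>\<close> maps
  \<open>e\<^sub>n\<close> to \<open>\<plusminus>e\<^bsub>f n\<^esub>\<close> for a permutation \<open>f\<close>. For large \<open>t\<close> the norm of \<open>x + t e\<^sub>n\<close> is \<open>x\<^sub>n + t\<close>, so
  that also \<open>(T x)\<^bsub>f n\<^esub> = \<plusminus>x\<^sub>n\<close>; evaluating this at indicator functions shows that \<open>f\<close> is an
  isomorphism of ideals. Conversely, a permutation acts isometrically on sequences.\<close>

section \<open>A norm condition invariant under isometries\<close>

text \<open>Geometrically, every line in direction \<open>x\<close> through a point of the unit ball
  of \<open>V\<close> meets the ball in a segment of length 2, its diameter; \<open>c\<close>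
  locates the midpoint.\<close>

definition peak :: "'a::real_normed_vector set \<Rightarrow> 'a \<Rightarrow> bool" where
  "peak V x \<longleftrightarrow> norm x = 1 \<and>
     (\<forall>y\<in>V. norm y \<le> 1 \<longrightarrow>
       (\<exists>c. norm (y + (c + 1) *\<^sub>R x) \<le> 1 \<and> norm (y + (c - 1) *\<^sub>R x) \<le> 1))"

lemma peak_image_iff:
  assumes V: "subspace V"
    and add: "\<And>x y. x \<in> V \<Longrightarrow> y \<in> V \<Longrightarrow> T (x + y) = T x + T y"
    and scale: "\<And>c x. x \<in> V \<Longrightarrow> T (c *\<^sub>R x) = c *\<^sub>R T x"
    and norm: "\<And>x. x \<in> V \<Longrightarrow> norm (T x) = norm x"
    and x: "x \<in> V"
  shows "peak (T ` V) (T x) \<longleftrightarrow> peak V x"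
proof -
  have "norm (T y + c *\<^sub>R T x) = norm (y + c *\<^sub>R x)" if "y \<in> V" for c y
    using that x by (metis V add scale norm subspace_add subspace_scale)
  then show ?thesis
    using x by (simp add: peak_def norm)
qed

section \<open>Indicators and coordinates\<close>

definition ind :: "nat set \<Rightarrow> ell_infty" where
  "ind A = Bcontfun (indicator A)"

lemma apply_ind [simp]: "apply_bcontfun (ind A) n = indicator A n"
proof -
  have "bounded (range (indicator A :: nat \<Rightarrow> real))"
    by (rule boundedI[where B = 1]) (auto simp: indicator_def)
  then show ?thesis
    by (simp add: ind_def bounded_seq_in_ell_infty)
qed

lemma norm_ell_infty_le_iff: "norm (x :: ell_infty) \<le> b \<longleftrightarrow> (\<forall>n. \<bar>apply_bcontfun x n\<bar> \<le> b)"
proof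
  assume "norm x \<le> b"
  then show "\<forall>n. \<bar>apply_bcontfun x n\<bar> \<le> b"
    using norm_bounded[of x] by (metis order_trans real_norm_def)
next
  assume "\<forall>n. \<bar>apply_bcontfun x n\<bar> \<le> b"
  then show "norm x \<le> b"
    by (intro norm_bound) auto
qed

lemma abs_apply_le_norm: "\<bar>apply_bcontfun (x :: ell_infty) n\<bar> \<le> norm x"
  using norm_bounded[of x n] by simp

lemma c0_idealD: "x \<in> c0_ideal \<I> \<Longrightarrow> 0 < \<epsilon> \<Longrightarrow> {n. \<epsilon> \<le> \<bar>apply_bcontfun x n\<bar>} \<in> \<I>"
  by (simp add: c0_ideal_def)

text \<open>Indicators encode the ideal in the space: the level 1 recovers \<open>A\<close>, and
  every positive level gives a subset of \<open>A\<close>.\<close>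

lemma ind_in_c0_ideal_iff:
  assumes "set_ideal_on UNIV \<I>"
  shows "ind A \<in> c0_ideal \<I> \<longleftrightarrow> A \<in> \<I>"
proof
  assume "ind A \<in> c0_ideal \<I>"
  then have "{n. \<bar>apply_bcontfun (ind A) n\<bar> \<ge> 1} \<in> \<I>"
    by (rule c0_idealD) simp
  moreover have "{n. \<bar>apply_bcontfun (ind A) n\<bar> \<ge> 1} = A"
    by (auto simp: indicator_def)
  ultimately show "A \<in> \<I>"
    by simp
next
  assume A: "A \<in> \<I>"
  show "ind A \<in> c0_ideal \<I>"
    unfolding c0_ideal_def mem_Collect_eq
  proof (intro allI impI)
    fix \<epsilon> :: real assume "\<epsilon> > 0"
    then have "{n. \<bar>apply_bcontfun (ind A) n\<bar> \<ge> \<epsilon>} \<subseteq> A"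
      by (auto simp: indicator_def split: if_splits)
    with A assms show "{n. \<bar>apply_bcontfun (ind A) n\<bar> \<ge> \<epsilon>} \<in> \<I>"
      unfolding set_ideal_on_def by blast
  qed
qed

lemma ind_singleton_in_c0_ideal:
  assumes "set_ideal_on UNIV \<I>"
  shows "ind {n} \<in> c0_ideal \<I>"
  using assms by (simp add: ind_in_c0_ideal_iff set_ideal_on_def)

lemma norm_ind_singleton: "norm (ind {n}) = 1"
proof (rule antisym)
  show "norm (ind {n}) \<le> 1"
    by (simp add: norm_ell_infty_le_iff indicator_def)
  show "1 \<le> norm (ind {n})"
    using abs_apply_le_norm[of "ind {n}" n] by simp
qed

section \<open>Peaks are the signed unit vectors\<close>

lemma peak_sign_ind_singleton:
  assumes "\<bar>s\<bar> = 1"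
  shows "peak V (s *\<^sub>R ind {n})"
  unfolding peak_def
proof (intro conjI ballI impI)
  show "norm (s *\<^sub>R ind {n}) = 1"
    using assms by (simp add: norm_ind_singleton)
  fix y :: ell_infty assume y: "norm y \<le> 1"
  have s: "s * s = 1"
    using assms by (metis abs_mult_self_eq mult_1)
  \<comment> \<open>This choice cancels coordinate \<open>n\<close> of \<open>y\<close>, leaving
    \<open>d * s\<close> of modulus 1 there; the other coordinates do not change.\<close>
  let ?c = "- s * apply_bcontfun y n"
  have "\<bar>apply_bcontfun (y + (?c + d) *\<^sub>R s *\<^sub>R ind {n}) m\<bar> \<le> 1" if "\<bar>d\<bar> = 1" for d m
  proof (cases "m = n")
    case True
    have "apply_bcontfun (y + (?c + d) *\<^sub>R s *\<^sub>R ind {n}) m =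
        apply_bcontfun y n - (s * s) * apply_bcontfun y n + d * s"
      using True by (simp add: plus_bcontfun.rep_eq scaleR_bcontfun.rep_eq algebra_simps)
    then show ?thesis
      using s assms that by (simp add: abs_mult)
  next
    case False
    then show ?thesis
      using y abs_apply_le_norm[of y m]
      by (simp add: plus_bcontfun.rep_eq scaleR_bcontfun.rep_eq)
  qed
  from this[of 1] this[of "- 1"]
  show "\<exists>c. norm (y + (c + 1) *\<^sub>R s *\<^sub>R ind {n}) \<le> 1 \<and>
      norm (y + (c - 1) *\<^sub>R s *\<^sub>R ind {n}) \<le> 1"
    unfolding norm_ell_infty_le_iff by (intro exI[of _ ?c]) simp
qed

text \<open>Testing \<open>peak\<close> with \<open>y = e\<^sub>k\<close> for \<open>k\<close> in the support of \<open>x\<close> forces \<open>\<bar>c\<bar> \<ge> 1\<close>,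
  and then \<open>\<bar>x\<^sub>j\<bar> \<le> 1/2\<close> at every other coordinate. Two points in the support would give
  \<open>norm x \<le> 1/2\<close>.\<close>

lemma peak_imp_sign_ind_singleton:
  assumes V: "\<And>n. ind {n} \<in> V" and x: "peak V x"
  obtains n s where "\<bar>s\<bar> = 1" "x = s *\<^sub>R ind {n}"
proof -
  let ?x = "apply_bcontfun x"
  have nx: "norm x = 1"
    using x by (simp add: peak_def)
  have half: "\<bar>?x j\<bar> \<le> 1/2" if k: "?x k \<noteq> 0" and j: "j \<noteq> k" for j k
  proof -
    obtain c where c: "norm (ind {k} + (c + 1) *\<^sub>R x) \<le> 1" "norm (ind {k} + (c - 1) *\<^sub>R x) \<le> 1"
      using x V[of k] norm_ind_singleton[of k] unfolding peak_def by (metis order_refl)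
    have ck: "\<bar>1 + (c + 1) * ?x k\<bar> \<le> 1" "\<bar>1 + (c - 1) * ?x k\<bar> \<le> 1"
      using c[unfolded norm_ell_infty_le_iff, rule_format, of k]
      by (simp_all add: plus_bcontfun.rep_eq scaleR_bcontfun.rep_eq)
    have cj: "\<bar>(c + 1) * ?x j\<bar> \<le> 1" "\<bar>(c - 1) * ?x j\<bar> \<le> 1"
      using c[unfolded norm_ell_infty_le_iff, rule_format, of j] j
      by (simp_all add: plus_bcontfun.rep_eq scaleR_bcontfun.rep_eq)
    have neg: "(c + 1) * ?x k \<le> 0" "(c - 1) * ?x k \<le> 0"
      using ck by linarith+
    \<comment> \<open>By \<open>neg\<close>, both factors have sign opposite to \<open>?x k\<close>
      or vanish. As they differ by 2, the one farther from 0 has modulus at least 2.\<close>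
    have "2 \<le> \<bar>c + 1\<bar> \<or> 2 \<le> \<bar>c - 1\<bar>"
    proof (cases "?x k > 0")
      case True
      then have "c + 1 \<le> 0"
        using neg by (simp add: mult_le_0_iff)
      then show ?thesis by linarith
    next
      case False
      then have "c - 1 \<ge> 0"
        using neg k by (simp add: mult_le_0_iff)
      then show ?thesis by linarith
    qed
    then show ?thesis
    proof
      assume "2 \<le> \<bar>c + 1\<bar>"
      then have "2 * \<bar>?x j\<bar> \<le> \<bar>c + 1\<bar> * \<bar>?x j\<bar>"
        by (intro mult_right_mono) auto
      with cj(1) show ?thesis
        by (simp add: abs_mult)
    next
      assume "2 \<le> \<bar>c - 1\<bar>"
      then have "2 * \<bar>?x j\<bar> \<le> \<bar>c - 1\<bar> * \<bar>?x j\<bar>"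
        by (intro mult_right_mono) auto
      with cj(2) show ?thesis
        by (simp add: abs_mult)
    qed
  qed
  obtain k where k: "?x k \<noteq> 0"
    using nx norm_ell_infty_le_iff[of x 0] by force
  have zero: "?x j = 0" if j: "j \<noteq> k" for j
  proof (rule ccontr)
    assume "?x j \<noteq> 0"
    \<comment> \<open>Each \<open>i\<close> differs from \<open>j\<close> or from \<open>k\<close>,
      so one of these serves as the support point in \<open>half\<close>.\<close>
    then have "\<bar>?x i\<bar> \<le> 1/2" for i
      using half[of j i] half[OF k, of i] j by metis
    then have "norm x \<le> 1/2"
      unfolding norm_ell_infty_le_iff by blast
    with nx show False by simp
  qed
  have eq: "x = ?x k *\<^sub>R ind {k}"
    by (rule bcontfun_eqI) (auto simp: scaleR_bcontfun.rep_eq zero indicator_def)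
  then have "norm x = \<bar>?x k\<bar> * norm (ind {k})"
    by (metis norm_scaleR)
  then have "\<bar>?x k\<bar> = 1"
    by (simp add: nx norm_ind_singleton)
  with eq show thesis
    using that by blast
qed

section \<open>From isometries to isomorphisms of ideals\<close>

text \<open>Coordinate \<open>n\<close> of the sum has modulus at least \<open>t - norm x\<close>,
  hence at least \<open>norm x\<close>, and so dominates all others. Thus the norm alone reads off a
  coordinate.\<close>

lemma norm_add_large_multiple_ind_singleton:
  assumes t: "2 * norm x \<le> t" and s: "\<bar>s\<bar> = 1"
  shows "norm (x + t *\<^sub>R s *\<^sub>R ind {n}) = s * apply_bcontfun x n + t"
proof -
  let ?y = "x + t *\<^sub>R s *\<^sub>R ind {n}"
  have s': "s = 1 \<or> s = - 1"
    using s by linarith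
  have at_n: "\<bar>apply_bcontfun ?y n\<bar> = s * apply_bcontfun x n + t"
    using s' t abs_apply_le_norm[of x n]
    by (auto simp: plus_bcontfun.rep_eq scaleR_bcontfun.rep_eq)
  have "\<bar>apply_bcontfun ?y m\<bar> \<le> s * apply_bcontfun x n + t" for m
  proof (cases "m = n")
    case False
    then show ?thesis
      using s' t abs_apply_le_norm[of x n] abs_apply_le_norm[of x m]
      by (auto simp: plus_bcontfun.rep_eq scaleR_bcontfun.rep_eq)
  qed (use at_n in simp)
  then show ?thesis
    using at_n abs_apply_le_norm[of ?y n] norm_ell_infty_le_iff[of ?y] by (metis order_antisym)
qed

lemma isometric_imp_isomorphic:
  assumes \<I>: "set_ideal_on UNIV \<I>" and \<J>: "set_ideal_on UNIV \<J>"
    and iso: "linearly_isometric (c0_ideal \<I>) (c0_ideal \<J>)"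
  shows "isomorphic_ideals \<I> \<J>"
proof -
  let ?V = "c0_ideal \<I>" and ?W = "c0_ideal \<J>"
  obtain T where add: "\<And>x y. x \<in> ?V \<Longrightarrow> y \<in> ?V \<Longrightarrow> T (x + y) = T x + T y"
    and scale: "\<And>c x. x \<in> ?V \<Longrightarrow> T (c *\<^sub>R x) = c *\<^sub>R T x"
    and norm: "\<And>x. x \<in> ?V \<Longrightarrow> norm (T x) = norm x"
    and onto: "T ` ?V = ?W"
    using iso unfolding linearly_isometric_def by metis
  note V = subspace_c0_ideal[OF \<I>]
  note eV = ind_singleton_in_c0_ideal[OF \<I>] and eW = ind_singleton_in_c0_ideal[OF \<J>]
  have peak_iff: "peak ?W (T x) \<longleftrightarrow> peak ?V x" if "x \<in> ?V" for x
    using peak_image_iff[OF V add scale norm that] by (simp add: onto)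
  have "\<exists>m s. \<bar>s\<bar> = 1 \<and> T (ind {n}) = s *\<^sub>R ind {m}" for n
  proof -
    have "peak ?W (T (ind {n}))"
      using peak_iff[OF eV] peak_sign_ind_singleton[of 1] by simp
    then show ?thesis
      using peak_imp_sign_ind_singleton[OF eW] by metis
  qed
  then obtain f s where s: "\<And>n. \<bar>s n\<bar> = 1" and Te: "\<And>n. T (ind {n}) = s n *\<^sub>R ind {f n}"
    by metis
  have coord: "s n * apply_bcontfun (T x) (f n) = apply_bcontfun x n" if x: "x \<in> ?V" for n x
  proof -
    \<comment> \<open>Since \<open>T\<close> preserves norms, the same \<open>?t\<close> is large
      enough for both \<open>x\<close> and \<open>T x\<close>.\<close>
    let ?t = "2 * norm x"
    have "norm (T x + ?t *\<^sub>R s n *\<^sub>R ind {f n}) = norm (T (x + ?t *\<^sub>R ind {n}))"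
      using add[OF x] scale eV Te subspace_scale[OF V] by metis
    also have "\<dots> = norm (x + ?t *\<^sub>R 1 *\<^sub>R ind {n})"
      using norm x eV subspace_scale[OF V] subspace_add[OF V] by simp
    also have "\<dots> = 1 * apply_bcontfun x n + ?t"
      by (rule norm_add_large_multiple_ind_singleton) auto
    finally show ?thesis
      using norm_add_large_multiple_ind_singleton[of "T x" ?t "s n" "f n"] s norm[OF x] by simp
  qed
  have abs_coord: "\<bar>apply_bcontfun (T x) (f n)\<bar> = \<bar>apply_bcontfun x n\<bar>" if "x \<in> ?V" for n x
    using coord[OF that, of n] s[of n] by (metis abs_mult mult_1)
  have "inj f"
  proof (rule injI)
    fix m n assume "f m = f n"
    then have "\<bar>apply_bcontfun (ind {m}) n\<bar> = \<bar>apply_bcontfun (ind {m}) m\<bar>"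
      using abs_coord[OF eV] by metis
    then show "m = n"
      by (simp add: indicator_def split: if_splits)
  qed
  moreover have "surj f"
    unfolding surj_def
  proof
    fix m
    obtain x where x: "x \<in> ?V" "T x = ind {m}"
      using onto eW[of m] by (metis imageE)
    then have "peak ?V x"
      using peak_iff peak_sign_ind_singleton[of 1] by (metis abs_one scaleR_one)
    then obtain n r where r: "\<bar>r\<bar> = 1" and xr: "x = r *\<^sub>R ind {n}"
      using peak_imp_sign_ind_singleton[OF eV] by metis
    \<comment> \<open>The preimage of a unit vector is again a signed unit vector, and its support
      \<open>n\<close> must be sent to \<open>m\<close>.\<close>
    have "\<bar>apply_bcontfun (ind {m}) (f n)\<bar> = 1"
      using abs_coord[OF x(1), of n, unfolded x(2)] r by (simp add: xr scaleR_bcontfun.rep_eq)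
    then show "\<exists>n. m = f n"
      by (auto simp: indicator_def split: if_splits)
  qed
  ultimately have "bij f"
    by (rule bijI)
  moreover have "A \<in> \<J> \<longleftrightarrow> f -` A \<in> \<I>" for A
  proof
    assume "A \<in> \<J>"
    then obtain x where x: "x \<in> ?V" "T x = ind A"
      using onto ind_in_c0_ideal_iff[OF \<J>] by (metis imageE)
    \<comment> \<open>By \<open>abs_coord\<close>, \<open>x\<close> has modulus 1 on the preimage of
      \<open>A\<close> and 0 elsewhere; its signs are irrelevant.\<close>
    have "{n. \<bar>apply_bcontfun x n\<bar> \<ge> 1} = f -` A"
      unfolding abs_coord[OF x(1), symmetric] x(2) by (auto simp: indicator_def)
    then show "f -` A \<in> \<I>"
      using c0_idealD[OF x(1), of 1] by simp
  next
    assume "f -` A \<in> \<I>"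
    then have x: "ind (f -` A) \<in> ?V"
      by (simp add: ind_in_c0_ideal_iff[OF \<I>])
    \<comment> \<open>\<open>abs_coord\<close> gives values of the image only on the range of
      \<open>f\<close>, hence the appeal to surjectivity.\<close>
    have "1 \<le> \<bar>apply_bcontfun (T (ind (f -` A))) m\<bar> \<longleftrightarrow> m \<in> A" for m
    proof -
      obtain n where "m = f n"
        using \<open>surj f\<close> by (metis surjD)
      then show ?thesis
        by (simp add: abs_coord[OF x] indicator_def)
    qed
    moreover have "T (ind (f -` A)) \<in> ?W"
      using x onto by blast
    then have "{m. 1 \<le> \<bar>apply_bcontfun (T (ind (f -` A))) m\<bar>} \<in> \<J>"
      by (rule c0_idealD) simp
    ultimately show "A \<in> \<J>"
      by simp
  qed
  ultimately show ?thesis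
    unfolding isomorphic_ideals_def by blast
qed

section \<open>From isomorphisms of ideals to isometries\<close>

definition reindex :: "(nat \<Rightarrow> nat) \<Rightarrow> ell_infty \<Rightarrow> ell_infty" where
  "reindex g x = Bcontfun (\<lambda>n. apply_bcontfun x (g n))"

lemma apply_reindex [simp]: "apply_bcontfun (reindex g x) n = apply_bcontfun x (g n)"
proof -
  have "bounded (range (\<lambda>n. apply_bcontfun x (g n)))"
    by (rule boundedI[where B = "norm x"]) (auto simp: abs_apply_le_norm)
  then show ?thesis
    by (simp add: reindex_def bounded_seq_in_ell_infty)
qed

lemma norm_reindex:
  assumes "surj g"
  shows "norm (reindex g x) = norm x"
proof -
  have "norm (reindex g x) \<le> b \<longleftrightarrow> norm x \<le> b" for b
    using assms by (simp add: norm_ell_infty_le_iff) (metis surjD)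
  then show ?thesis
    by (metis order_antisym order_refl)
qed

lemma isomorphic_imp_isometric:
  assumes "isomorphic_ideals \<I> \<J>"
  shows "linearly_isometric (c0_ideal \<I>) (c0_ideal \<J>)"
proof -
  obtain f where f: "bij f" and iff: "\<And>A. A \<in> \<J> \<longleftrightarrow> f -` A \<in> \<I>"
    using assms unfolding isomorphic_ideals_def by metis
  let ?T = "reindex (inv f)"
  have inv: "inv f (f n) = n" "f (inv f n) = n" for n
    using f by (simp_all add: bij_is_inj bij_is_surj surj_f_inv_f)
  \<comment> \<open>The level sets of \<open>reindex f y\<close> are the preimages under
    \<open>f\<close> of those of \<open>y\<close>.\<close>
  have mem: "reindex f y \<in> c0_ideal \<I> \<longleftrightarrow> y \<in> c0_ideal \<J>" for y
    by (simp add: c0_ideal_def iff vimage_def)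
  have right: "?T (reindex f y) = y" and left: "reindex f (?T y) = y" for y
    by (auto intro: bcontfun_eqI simp: inv)
  have "?T ` c0_ideal \<I> = c0_ideal \<J>"
    using mem left right by (metis (no_types, lifting) image_eqI imageE subsetI subset_antisym)
  moreover have "?T (x + y) = ?T x + ?T y" "?T (c *\<^sub>R x) = c *\<^sub>R ?T x" for x y c
    by (auto intro: bcontfun_eqI simp: plus_bcontfun.rep_eq scaleR_bcontfun.rep_eq)
  moreover have "norm (?T x) = norm x" for x
    using f by (intro norm_reindex bij_is_surj bij_imp_bij_inv)
  ultimately show ?thesis
    unfolding linearly_isometric_def by blast
qed

theorem theorem3p3:
  fixes \<I> \<J> :: "nat set set"
  assumes "set_ideal_on UNIV \<I>" and "set_ideal_on UNIV \<J>"
  shows "linearly_isometric (c0_ideal \<I>) (c0_ideal \<J>) \<longleftrightarrow> isomorphic_ideals \<I> \<J>"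
  using assms isometric_imp_isomorphic isomorphic_imp_isometric by blast

end
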